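(* Let $-\infty<a<b<+\infty$. Let $g:[a,b]\to\mathbb{R}$ be continuous, strictly increasing and positive on $[a,b)$, with a continuous first-order derivative $g^{(1)}$ on $(a,b)$ such that $g^{(1)}(x)\neq0$ for all $x\in(a,b)$. Let $(M,K)$ be a kernel pair in the Luchko set on $(0,\ell]$ with $\ell=g(b)-g(a)$. Then the parametric general fractional integrals with respect to $g$ are expressed via the general fractional integrals on the interval $(g(a),g(b))$ as follows: $$(I^{(M)}_{a+,g}f)(x)=\bigl(Q_g\,I^{(M)}_{g(a)+}\,Q_g^{-1}f\bigr)(x)\qquad (a<x\le b)$$ if $f\in C_{-1,g}(a,b]$, and $$(I^{(M)}_{b-,g}f)(x)=\bigl(Q_g\,I^{(M)}_{g(b)-}\,Q_g^{-1}f\bigr)(x)\qquad (a\le x<b)$$ if $f\in C_{-1,g}[a,b)$.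
   Context: Substitution operators: $(Q_g\varphi)(x)=\varphi(g(x))$ and $(Q_g^{-1}f)(y)=f(g^{-1}(y))$, where $g^{-1}:[g(a),g(b)]\to[a,b]$ is the inverse of $g$. $f\in C_{-1,g}(a,b]$ means $f(x)=(g(x)-g(a))^p\,m(x)$ on $(a,b]$ for some $p>-1$ and $m\in C[a,b]$. $f\in C_{-1,g}[a,b)$ means $f(x)=(g(b)-g(x))^q\,m(x)$ on $[a,b)$ for some $q>-1$ and $m\in C[a,b]$. For $\ell>0$, $F\in C_{-1}(0,\ell]$ means $F(x)=x^pG(x)$ on $(0,\ell]$ for some $p>-1$ and $G\in C[0,\ell]$. A pair $(M,K)$ belongs to the Luchko set on $(0,\ell]$ if $M,K\in C_{-1}(0,\ell]$ and $\int_0^x M(x-z)K(z)\,dz=1$ for all $x\in(0,\ell]$. Parametric general fractional integrals: $$(I^{(M)}_{a+,g}f)(x)=\int_a^x M(g(x)-g(u))f(u)g^{(1)}(u)\,du,\qquad (I^{(M)}_{b-,g}f)(x)=\int_x^b M(g(u)-g(x))f(u)g^{(1)}(u)\,du.$$ General fractional integrals on a finite interval $(c,d)$: $$(I^{(M)}_{c+}\varphi)(y)=\int_c^y M(y-\xi)\varphi(\xi)\,d\xi,\qquad (I^{(M)}_{d-}\varphi)(y)=\int_y^d M(\xi-y)\varphi(\xi)\,d\xi.$$ *)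

theory Defs
  imports "HOL-Analysis.Analysis"
begin

text \<open>
  All functions are total functions of type \<^typ>\<open>real \<Rightarrow> real\<close>; only their values on the
  mathematically relevant interval matter. Integrals are Lebesgue integrals over the open interval:
  the kernels and the densities may be undefined (or singular) at its endpoints.
\<close>

definition C_m1 :: "real \<Rightarrow> (real \<Rightarrow> real) set" where
  "C_m1 l = {F. \<exists>p>-1. \<exists>G. continuous_on {0..l} G \<and> (\<forall>x\<in>{0<..l}. F x = x powr p * G x)}"

definition C_m1_left :: "(real \<Rightarrow> real) \<Rightarrow> real \<Rightarrow> real \<Rightarrow> (real \<Rightarrow> real) set" where
  "C_m1_left g a b =
     {f. \<exists>p>-1. \<exists>m. continuous_on {a..b} m \<and> (\<forall>x\<in>{a<..b}. f x = (g x - g a) powr p * m x)}"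

definition C_m1_right :: "(real \<Rightarrow> real) \<Rightarrow> real \<Rightarrow> real \<Rightarrow> (real \<Rightarrow> real) set" where
  "C_m1_right g a b =
     {f. \<exists>q>-1. \<exists>m. continuous_on {a..b} m \<and> (\<forall>x\<in>{a..<b}. f x = (g b - g x) powr q * m x)}"

text \<open>
  The convolution integral below is required to be \<open>1\<close>, so its integrand is automatically
  integrable (a non-integrable function has Bochner integral \<open>0\<close>).
\<close>

definition Luchko_set :: "real \<Rightarrow> ((real \<Rightarrow> real) \<times> (real \<Rightarrow> real)) set" where
  "Luchko_set l = {(M, K). M \<in> C_m1 l \<and> K \<in> C_m1 l \<and>
     (\<forall>x\<in>{0<..l}. (LINT z:{0<..<x}|lborel. M (x - z) * K z) = 1)}"

definition Q_subst :: "(real \<Rightarrow> real) \<Rightarrow> (real \<Rightarrow> real) \<Rightarrow> real \<Rightarrow> real" where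
  "Q_subst g \<phi> x = \<phi> (g x)"

definition Q_subst_inv :: "(real \<Rightarrow> real) \<Rightarrow> real \<Rightarrow> real \<Rightarrow> (real \<Rightarrow> real) \<Rightarrow> real \<Rightarrow> real" where
  "Q_subst_inv g a b f y = f (the_inv_into {a..b} g y)"

definition pgfi_left ::
  "(real \<Rightarrow> real) \<Rightarrow> real \<Rightarrow> (real \<Rightarrow> real) \<Rightarrow> (real \<Rightarrow> real) \<Rightarrow> real \<Rightarrow> real" where
  "pgfi_left M a g f x = (LINT u:{a<..<x}|lborel. M (g x - g u) * f u * deriv g u)"

definition pgfi_right ::
  "(real \<Rightarrow> real) \<Rightarrow> real \<Rightarrow> (real \<Rightarrow> real) \<Rightarrow> (real \<Rightarrow> real) \<Rightarrow> real \<Rightarrow> real" where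
  "pgfi_right M b g f x = (LINT u:{x<..<b}|lborel. M (g u - g x) * f u * deriv g u)"

definition gfi_left :: "(real \<Rightarrow> real) \<Rightarrow> real \<Rightarrow> (real \<Rightarrow> real) \<Rightarrow> real \<Rightarrow> real" where
  "gfi_left M c \<phi> y = (LINT \<xi>:{c<..<y}|lborel. M (y - \<xi>) * \<phi> \<xi>)"

definition gfi_right :: "(real \<Rightarrow> real) \<Rightarrow> real \<Rightarrow> (real \<Rightarrow> real) \<Rightarrow> real \<Rightarrow> real" where
  "gfi_right M d \<phi> y = (LINT \<xi>:{y<..<d}|lborel. M (\<xi> - y) * \<phi> \<xi>)"

text \<open>
  Since the Bochner integral of a non-integrable function is \<open>0\<close> by convention, the following
  predicates express that the value of each operator at a point is a genuine integral.
\<close>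

definition pgfi_left_exists ::
  "(real \<Rightarrow> real) \<Rightarrow> real \<Rightarrow> (real \<Rightarrow> real) \<Rightarrow> (real \<Rightarrow> real) \<Rightarrow> real \<Rightarrow> bool" where
  "pgfi_left_exists M a g f x \<longleftrightarrow>
     set_integrable lborel {a<..<x} (\<lambda>u. M (g x - g u) * f u * deriv g u)"

definition pgfi_right_exists ::
  "(real \<Rightarrow> real) \<Rightarrow> real \<Rightarrow> (real \<Rightarrow> real) \<Rightarrow> (real \<Rightarrow> real) \<Rightarrow> real \<Rightarrow> bool" where
  "pgfi_right_exists M b g f x \<longleftrightarrow>
     set_integrable lborel {x<..<b} (\<lambda>u. M (g u - g x) * f u * deriv g u)"

definition gfi_left_exists :: "(real \<Rightarrow> real) \<Rightarrow> real \<Rightarrow> (real \<Rightarrow> real) \<Rightarrow> real \<Rightarrow> bool" where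
  "gfi_left_exists M c \<phi> y \<longleftrightarrow> set_integrable lborel {c<..<y} (\<lambda>\<xi>. M (y - \<xi>) * \<phi> \<xi>)"

definition gfi_right_exists :: "(real \<Rightarrow> real) \<Rightarrow> real \<Rightarrow> (real \<Rightarrow> real) \<Rightarrow> real \<Rightarrow> bool" where
  "gfi_right_exists M d \<phi> y \<longleftrightarrow> set_integrable lborel {y<..<d} (\<lambda>\<xi>. M (\<xi> - y) * \<phi> \<xi>)"

end

theory Submission
  imports Defs
begin

text \<open>
  In the variable \<open>y = g u\<close> both integrands take the form \<open>(y - c) powr p * (d - y) powr q * H y\<close>
  on an interval \<open>(c, d)\<close> with \<open>p, q > -1\<close> and \<open>H\<close> continuous on \<open>[c, d]\<close>: one power comes from the
  kernel, the other from the density. Such a function is absolutely integrable by comparison with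
  Euler's Beta integral, so the change of variables theorem for absolutely integrable functions
  applies and yields existence of both integrals together with their equality.
\<close>

section \<open>Passage between Borel and Lebesgue integrals\<close>

text \<open>The operators are integrals over \<open>lborel\<close>, while the change of variables
  theorem speaks of absolute integrability over \<open>lebesgue\<close>. Continuity on a Borel set
  makes the function cut off outside it Borel measurable, and completing the measure then does not
  affect integrability.\<close>

lemma set_integrable_lborel_iff_lebesgue:
  fixes h :: "real \<Rightarrow> real"
  assumes "continuous_on S h" "S \<in> sets borel"
  shows "set_integrable lborel S h \<longleftrightarrow> h absolutely_integrable_on S"
  using borel_measurable_continuous_on_indicator[OF assms(2,1)]
  by (simp add: set_integrable_def integrable_completion)

lemma set_lebesgue_integral_lborel_eq_integral:
  fixes h :: "real \<Rightarrow> real"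
  assumes "continuous_on S h" "S \<in> sets borel" "h absolutely_integrable_on S"
  shows "(LINT x:S|lborel. h x) = integral S h"
proof -
  have "(LINT x:S|lborel. h x) = (LINT x:S|lebesgue. h x)"
    using borel_measurable_continuous_on_indicator[OF assms(2,1)]
    by (simp add: set_lebesgue_integral_def integral_completion)
  then show ?thesis
    using set_lebesgue_integral_eq_integral(2)[OF assms(3)] by simp
qed

section \<open>Integrability of Beta weights\<close>

text \<open>The affine map \<open>?r\<close> reduces the claim to Euler's integral for Beta(p + 1, q
  + 1) on (0, 1); since the weight is nonnegative, integrability there is already absolute.\<close>

lemma absolutely_integrable_Beta_weight:
  fixes c d p q :: real
  assumes "c < d" "p > -1" "q > -1"
  shows "(\<lambda>x. (x - c) powr p * (d - x) powr q) absolutely_integrable_on {c<..<d}"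
proof -
  let ?w = "\<lambda>t::real. t powr p * (1 - t) powr q"
  let ?r = "\<lambda>x. (x - c) / (d - c)"
  have "?w integrable_on {0<..<1}"
    using has_integral_Beta_real[of "p + 1" "q + 1"] assms(2,3)
    by (auto simp: has_integral_Icc_iff_Ioo integrable_on_def)
  then have w: "?w absolutely_integrable_on {0<..<1}"
    by (rule nonnegative_absolutely_integrable_1) auto
  have im: "?r ` {c<..<d} = {0<..<1}"
  proof (intro equalityI subsetI)
    fix t :: real
    assume "t \<in> {0<..<1}"
    then have "0 < t * (d - c)" "t * (d - c) < d - c"
      using assms(1) mult_strict_right_mono[of t 1 "d - c"] by auto
    then have "c + t * (d - c) \<in> {c<..<d}" "t = ?r (c + t * (d - c))"
      by auto
    then show "t \<in> ?r ` {c<..<d}" by blast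
  qed (use assms(1) in \<open>auto simp: field_simps\<close>)
  have "?w absolutely_integrable_on ?r ` {c<..<d} \<longleftrightarrow>
      (\<lambda>x. \<bar>1 / (d - c)\<bar> *\<^sub>R ?w (?r x)) absolutely_integrable_on {c<..<d}"
  proof (rule absolutely_integrable_change_of_variables_real)
    show "(?r has_field_derivative 1 / (d - c)) (at x within {c<..<d})" for x
      using assms(1) by (auto intro!: derivative_eq_intros)
    show "inj_on ?r {c<..<d}"
      using assms(1) by (auto intro!: inj_onI)
  qed simp
  with w have "(\<lambda>x. \<bar>1 / (d - c)\<bar> *\<^sub>R ?w (?r x)) absolutely_integrable_on {c<..<d}"
    by (simp only: im)
  \<comment> \<open>Rescaling the two powers costs \<open>(d - c) powr (- p - q)\<close> and the
    Jacobian costs \<open>1 / (d - c)\<close>; this constant cancels both.\<close>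
  then have "(\<lambda>x. (d - c) powr (p + q + 1) * (\<bar>1 / (d - c)\<bar> *\<^sub>R ?w (?r x)))
      absolutely_integrable_on {c<..<d}"
    by (rule set_integrable_mult_right)
  moreover have "(d - c) powr (p + q + 1) * (\<bar>1 / (d - c)\<bar> *\<^sub>R ?w (?r x))
      = (x - c) powr p * (d - x) powr q" if "x \<in> {c<..<d}" for x
  proof -
    have "1 - ?r x = (d - x) / (d - c)"
      using assms(1) by (simp add: field_simps)
    then show ?thesis
      using that by (simp add: powr_divide powr_add)
  qed
  ultimately show ?thesis
    by (rule set_integrable_cong[THEN iffD1, OF refl refl, rotated])
qed

lemma continuous_on_Beta_weight:
  fixes c d p q :: real
  shows "continuous_on {c<..<d} (\<lambda>x. (x - c) powr p * (d - x) powr q)"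
  by (intro continuous_intros) auto

text \<open>Compactness of \<open>{c..d}\<close> makes \<open>H\<close> bounded, and a bounded
  measurable factor preserves absolute integrability.\<close>

lemma absolutely_integrable_Beta_weight_mult:
  fixes c d p q :: real
  assumes "c < d" "p > -1" "q > -1" "continuous_on {c..d} H"
  shows "(\<lambda>x. (x - c) powr p * (d - x) powr q * H x) absolutely_integrable_on {c<..<d}"
proof -
  have "bounded (H ` {c<..<d})"
    using compact_imp_bounded[OF compact_continuous_image[OF assms(4)]]
    by (rule bounded_subset) auto
  moreover have "H \<in> borel_measurable (lebesgue_on {c<..<d})"
    by (rule continuous_imp_measurable_on_sets_lebesgue)
       (use assms(4) in \<open>auto intro: continuous_on_subset\<close>)
  ultimately have "(\<lambda>x. H x * ((x - c) powr p * (d - x) powr q)) absolutely_integrable_on {c<..<d}"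
    using absolutely_integrable_Beta_weight[OF assms(1-3)]
    by (intro absolutely_integrable_bounded_measurable_product_real[where f = H]) auto
  then show ?thesis
    by (simp only: mult.commute)
qed

section \<open>Substitution along a strictly increasing function\<close>

lemma strict_mono_on_image_Ioo:
  fixes g :: "real \<Rightarrow> real"
  assumes "s \<le> t" "continuous_on {s..t} g" "strict_mono_on {s..t} g"
  shows "g ` {s<..<t} = {g s<..<g t}"
proof (intro equalityI subsetI)
  fix y
  assume y: "y \<in> {g s<..<g t}"
  then obtain x where "x \<in> {s..t}" "g x = y"
    using IVT'[of g s y t] assms(1,2) by auto
  with y show "y \<in> g ` {s<..<t}"
    by (cases "x = s \<or> x = t") auto
qed (use assms in \<open>auto simp: strict_mono_on_def\<close>)

text \<open>This removes the absolute value that the change of variables theorem puts on the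
  derivative. A negative derivative would make \<open>g\<close> smaller just to the right of
  \<open>x\<close>.\<close>

lemma deriv_nonneg_of_strict_mono_on:
  fixes g :: "real \<Rightarrow> real"
  assumes "strict_mono_on {a..b} g" "x \<in> {a<..<b}" "g differentiable (at x)"
  shows "deriv g x \<ge> 0"
proof (rule ccontr)
  assume "\<not> deriv g x \<ge> 0"
  then have "deriv g x < 0"
    by simp
  moreover have "DERIV g x :> deriv g x"
    using assms(3) by (simp add: DERIV_deriv_iff_real_differentiable)
  ultimately obtain e where e: "e > 0" "\<And>h. h > 0 \<Longrightarrow> h < e \<Longrightarrow> g (x + h) < g x"
    using DERIV_neg_dec_right by blast
  \<comment> \<open>The second bound keeps \<open>x + h\<close> inside the interval where
    \<open>g\<close> is monotone.\<close>
  define h where "h = min (e / 2) ((b - x) / 2)"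
  have "h > 0" "h < e" "x \<in> {a..b}" "x + h \<in> {a..b}"
    using e(1) assms(2) by (auto simp: h_def min_def field_simps)
  then show False
    using e(2)[of h] strict_mono_onD[OF assms(1)] by force
qed

text \<open>Integrability is assumed only in the variable \<open>y = g u\<close> and is carried back
  to \<open>u\<close>. Working on open intervals allows \<open>deriv g\<close> and \<open>h\<close>
  to be unbounded at the endpoints.\<close>

lemma set_integral_substitution:
  fixes g h :: "real \<Rightarrow> real"
  assumes "s \<le> t" "continuous_on {s..t} g" "strict_mono_on {s..t} g"
    and diff: "\<forall>x\<in>{s<..<t}. g differentiable (at x)"
    and cont: "continuous_on {s<..<t} (deriv g)"
    and h: "continuous_on {g s<..<g t} h" "h absolutely_integrable_on {g s<..<g t}"
  shows "set_integrable lborel {s<..<t} (\<lambda>u. h (g u) * deriv g u) \<and>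
    set_integrable lborel {g s<..<g t} h \<and>
    (LINT u:{s<..<t}|lborel. h (g u) * deriv g u) = (LINT y:{g s<..<g t}|lborel. h y)"
proof -
  let ?k = "\<lambda>u. h (g u) * deriv g u"
  have im: "g ` {s<..<t} = {g s<..<g t}"
    using assms(1-3) by (rule strict_mono_on_image_Ioo)
  have eq: "\<bar>deriv g u\<bar> * h (g u) = ?k u" if "u \<in> {s<..<t}" for u
    using deriv_nonneg_of_strict_mono_on[OF assms(3) that] diff that by (simp add: mult.commute)
  have contk: "continuous_on {s<..<t} ?k"
    using im
    by (intro continuous_on_mult cont continuous_on_compose2[OF h(1)] continuous_on_subset[OF assms(2)]) auto
  have "(\<lambda>u. \<bar>deriv g u\<bar> * h (g u)) absolutely_integrable_on {s<..<t} \<and>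
      integral {s<..<t} (\<lambda>u. \<bar>deriv g u\<bar> * h (g u)) = integral {g s<..<g t} h"
    \<comment> \<open>The theorem is an equivalence, so the integrability of \<open>h\<close> on the
      image of \<open>g\<close> suffices.\<close>
    by (subst has_absolute_integral_change_of_variables_1')
       (use h im diff strict_mono_on_imp_inj_on[OF assms(3)] in
        \<open>auto simp: DERIV_deriv_iff_real_differentiable intro: has_field_derivative_at_within inj_on_subset\<close>)
  then have "?k absolutely_integrable_on {s<..<t}" "integral {s<..<t} ?k = integral {g s<..<g t} h"
    using set_integrable_cong[OF refl refl eq, where M = lebesgue and A = "{s<..<t}"]
      integral_cong[OF eq, where s = "{s<..<t}"] by auto
  then show ?thesis
    using contk h by (simp add: set_integrable_lborel_iff_lebesgue set_lebesgue_integral_lborel_eq_integral)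
qed

text \<open>The common form of both operators. \<open>h\<close> and \<open>k\<close> are prescribed
  only on the open intervals, because kernel and density may take arbitrary values at the singular
  endpoints.\<close>

lemma set_integral_substitution_Beta_weight:
  fixes g h H :: "real \<Rightarrow> real"
  assumes "s < t" "continuous_on {s..t} g" "strict_mono_on {s..t} g"
    and "\<forall>x\<in>{s<..<t}. g differentiable (at x)"
    and "continuous_on {s<..<t} (deriv g)"
    and "p > -1" "q > -1" "continuous_on {g s..g t} H"
    and h: "\<And>y. y \<in> {g s<..<g t} \<Longrightarrow> h y = (y - g s) powr p * (g t - y) powr q * H y"
    and k: "\<And>u. u \<in> {s<..<t} \<Longrightarrow> k u = h (g u) * deriv g u"
  shows "set_integrable lborel {s<..<t} k \<and>
    set_integrable lborel {g s<..<g t} h \<and>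
    (LINT u:{s<..<t}|lborel. k u) = (LINT y:{g s<..<g t}|lborel. h y)"
proof -
  have gst: "g s < g t"
    using assms(1,3) by (simp add: strict_mono_on_def)
  have "h absolutely_integrable_on {g s<..<g t}"
    using absolutely_integrable_Beta_weight_mult[OF gst assms(6-8)]
    by (rule set_integrable_cong[THEN iffD2, OF refl refl h, rotated])
  moreover have "continuous_on {g s<..<g t} (\<lambda>y. (y - g s) powr p * (g t - y) powr q * H y)"
    by (intro continuous_on_mult continuous_on_Beta_weight continuous_on_subset[OF assms(8)]) auto
  then have "continuous_on {g s<..<g t} h"
    by (rule continuous_on_cong[THEN iffD2, OF refl h, rotated])
  ultimately have "set_integrable lborel {s<..<t} (\<lambda>u. h (g u) * deriv g u) \<and>
    set_integrable lborel {g s<..<g t} h \<and>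
    (LINT u:{s<..<t}|lborel. h (g u) * deriv g u) = (LINT y:{g s<..<g t}|lborel. h y)"
    using assms(1-5) by (intro set_integral_substitution) auto
  moreover have "(LINT u:{s<..<t}|lborel. k u) = (LINT u:{s<..<t}|lborel. h (g u) * deriv g u)"
    by (rule set_lebesgue_integral_cong) (use k in auto)
  ultimately show ?thesis
    using set_integrable_cong[OF refl refl k, where M = lborel and A = "{s<..<t}"] by auto
qed

section \<open>The two operator identities\<close>

theorem proposition3:
  fixes a b :: real and g M K f :: "real \<Rightarrow> real"
  assumes "a < b"
    and "continuous_on {a..b} g"
    and "strict_mono_on {a..b} g"
    and "\<forall>x\<in>{a..<b}. g x > 0"
    and "\<forall>x\<in>{a<..<b}. g differentiable (at x)"
    and "continuous_on {a<..<b} (deriv g)"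
    and "\<forall>x\<in>{a<..<b}. deriv g x \<noteq> 0"
    and "(M, K) \<in> Luchko_set (g b - g a)"
  shows
    "(f \<in> C_m1_left g a b \<longrightarrow>
        (\<forall>x\<in>{a<..b}.
           pgfi_left_exists M a g f x \<and>
           gfi_left_exists M (g a) (Q_subst_inv g a b f) (g x) \<and>
           pgfi_left M a g f x = Q_subst g (gfi_left M (g a) (Q_subst_inv g a b f)) x)) \<and>
     (f \<in> C_m1_right g a b \<longrightarrow>
        (\<forall>x\<in>{a..<b}.
           pgfi_right_exists M b g f x \<and>
           gfi_right_exists M (g b) (Q_subst_inv g a b f) (g x) \<and>
           pgfi_right M b g f x = Q_subst g (gfi_right M (g b) (Q_subst_inv g a b f)) x))"
proof -
  let ?i = "the_inv_into {a..b} g"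
  have inj: "inj_on g {a..b}"
    using assms(3) by (rule strict_mono_on_imp_inj_on)
  have i[simp]: "?i (g u) = u" if "u \<in> {a..b}" for u
    using inj that by (rule the_inv_into_f_f)
  have mono: "g u \<le> g v" if "u \<in> {a..b}" "v \<in> {a..b}" "u \<le> v" for u v
    using strict_mono_on_leD[OF assms(3) that] .
  have im: "g ` {a..b} = {g a..g b}"
  proof (intro equalityI subsetI)
    fix y
    assume "y \<in> {g a..g b}"
    then show "y \<in> g ` {a..b}"
      using IVT'[of g a y b] assms(1,2) by auto
  qed (use assms(1) mono in auto)
  \<comment> \<open>The inverse of a continuous injection on a compact set is continuous.\<close>
  have conti: "continuous_on {g a..g b} ?i"
    using continuous_on_inv[OF assms(2), of ?i] im by simp
  have i_mem: "?i y \<in> {a..b}" and g_i: "g (?i y) = y" if "y \<in> {g a..g b}" for y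
    using that im the_inv_into_into[OF inj, of y "{a..b}"] f_the_inv_into_f[OF inj, of y] by auto
  from assms(8) obtain p G where p: "p > -1" and G: "continuous_on {0..g b - g a} G"
    and M: "\<And>x. x \<in> {0<..g b - g a} \<Longrightarrow> M x = x powr p * G x"
    unfolding Luchko_set_def C_m1_def by auto
  have left: "pgfi_left_exists M a g f x \<and>
      gfi_left_exists M (g a) (Q_subst_inv g a b f) (g x) \<and>
      pgfi_left M a g f x = Q_subst g (gfi_left M (g a) (Q_subst_inv g a b f)) x"
    if f: "f \<in> C_m1_left g a b" and x: "x \<in> {a<..b}" for x
  proof -
    from f obtain q m where q: "q > -1" and m: "continuous_on {a..b} m"
      and fm: "\<And>x. x \<in> {a<..b} \<Longrightarrow> f x = (g x - g a) powr q * m x"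
      unfolding C_m1_left_def by auto
    let ?h = "\<lambda>y. M (g x - y) * f (?i y)"
    \<comment> \<open>This is the product without its singular powers. For \<open>y\<close> in
      \<open>{g a..g x}\<close> the argument \<open>g x - y\<close> stays in
      \<open>{0..g b - g a}\<close>, where \<open>G\<close> is continuous.\<close>
    let ?H = "\<lambda>y. G (g x - y) * m (?i y)"
    have gx: "g x \<le> g b"
      using mono x assms(1) by auto
    have H: "continuous_on {g a..g x} ?H"
      using gx i_mem
      by (intro continuous_on_mult continuous_on_compose2[OF G] continuous_on_compose2[OF m]
          continuous_on_subset[OF conti] continuous_intros) auto
    have h: "?h y = (y - g a) powr q * (g x - y) powr p * ?H y" if "y \<in> {g a<..<g x}" for y
    proof -
      have y: "y \<in> {g a..g b}" "y \<noteq> g a"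
        using that gx by auto
      \<comment> \<open>The point \<open>a\<close> must be excluded, since the representation of
        \<open>f\<close> says nothing about \<open>f a\<close>.\<close>
      then have "?i y \<in> {a<..b}"
        using i_mem[of y] g_i[of y] by (cases "?i y = a") auto
      then show ?thesis
        using fm[of "?i y"] M[of "g x - y"] g_i[OF y(1)] that gx by simp
    qed
    show ?thesis
      unfolding pgfi_left_exists_def gfi_left_exists_def pgfi_left_def gfi_left_def
        Q_subst_def Q_subst_inv_def
    \<comment> \<open>The exponents are swapped: the density is singular at the left end
      \<open>g a\<close> with exponent \<open>q\<close>, the kernel at the right end
      \<open>g x\<close> with exponent \<open>p\<close>.\<close>
    proof (rule set_integral_substitution_Beta_weight[where p = q and q = p and H = ?H])
      show "continuous_on {a..x} g"
        using x by (auto intro: continuous_on_subset[OF assms(2)])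
      show "strict_mono_on {a..x} g"
        using x by (auto intro: monotone_on_subset[OF assms(3)])
      show "continuous_on {a<..<x} (deriv g)"
        using x by (auto intro: continuous_on_subset[OF assms(6)])
    qed (use x p q H h assms(5) in auto)
  qed
  have right: "pgfi_right_exists M b g f x \<and>
      gfi_right_exists M (g b) (Q_subst_inv g a b f) (g x) \<and>
      pgfi_right M b g f x = Q_subst g (gfi_right M (g b) (Q_subst_inv g a b f)) x"
    if f: "f \<in> C_m1_right g a b" and x: "x \<in> {a..<b}" for x
  proof -
    from f obtain q m where q: "q > -1" and m: "continuous_on {a..b} m"
      and fm: "\<And>x. x \<in> {a..<b} \<Longrightarrow> f x = (g b - g x) powr q * m x"
      unfolding C_m1_right_def by auto
    let ?h = "\<lambda>y. M (y - g x) * f (?i y)"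
    let ?H = "\<lambda>y. G (y - g x) * m (?i y)"
    have gx: "g a \<le> g x"
      using mono x assms(1) by auto
    have H: "continuous_on {g x..g b} ?H"
      using gx i_mem
      by (intro continuous_on_mult continuous_on_compose2[OF G] continuous_on_compose2[OF m]
          continuous_on_subset[OF conti] continuous_intros) auto
    have h: "?h y = (y - g x) powr p * (g b - y) powr q * ?H y" if "y \<in> {g x<..<g b}" for y
    proof -
      have y: "y \<in> {g a..g b}" "y \<noteq> g b"
        using that gx by auto
      then have "?i y \<in> {a..<b}"
        using i_mem[of y] g_i[of y] by (cases "?i y = b") auto
      then show ?thesis
        using fm[of "?i y"] M[of "y - g x"] g_i[OF y(1)] that gx by simp
    qed
    show ?thesis
      unfolding pgfi_right_exists_def gfi_right_exists_def pgfi_right_def gfi_right_def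
        Q_subst_def Q_subst_inv_def
    \<comment> \<open>In this mirror image the kernel is singular at the left end \<open>g x\<close>
      and the density at the right end \<open>g b\<close>, so the exponents keep their
      places.\<close>
    proof (rule set_integral_substitution_Beta_weight[where p = p and q = q and H = ?H])
      show "continuous_on {x..b} g"
        using x by (auto intro: continuous_on_subset[OF assms(2)])
      show "strict_mono_on {x..b} g"
        using x by (auto intro: monotone_on_subset[OF assms(3)])
      show "continuous_on {x<..<b} (deriv g)"
        using x by (auto intro: continuous_on_subset[OF assms(6)])
    qed (use x p q H h assms(5) in auto)
  qed
  show ?thesis
    using left right by blast
qed

end
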